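(* Let $d\ge1$ and let $\mathbf S=B^\top B\in\mathbb R^{d\times d}$ for a real matrix $B$ with $d$ columns. For every integer $q\ge1$ and all non-negative integers $k_1,\dots,k_q,m_1,\dots,m_q$, put $$\alpha_0^q=m_1,\qquad \alpha_i^q=k_i+m_{i+1}\ \ (i=1,\dots,q-1),\qquad \alpha_q^q=k_q .$$ Then $$N(q;k_1,k_2,\dots,k_q\mid m_q,\dots,m_2,m_1)=\sum_{\star}\mathrm{Eval}\big(s_{\alpha_0^q}\star s_{\alpha_1^q}\star\cdots\star s_{\alpha_q^q}\big),$$ where $\mathrm{Eval}$ is the evaluation determined by $\mathrm{Eval}(s_i)=\operatorname{Tr}(\mathbf S^i)$.
   Context: Let $X_1,X_2,\dots$ be i.i.d. $d$-variate standard Gaussian (column) vectors. Define $$N(q;k_1,\dots,k_q\mid m_q,m_{q-1},\dots,m_1)=\mathbb E\Big[\operatorname{Tr}\Big(\prod_{i=1}^q\big(X_iX_i^\top\mathbf S^{k_i}\big)\prod_{i=1}^q\big(X_{q+1-i}X_{q+1-i}^\top\mathbf S^{m_{q+1-i}}\big)\Big)\Big],$$ with products ordered left to right in increasing $i$, and $\mathbf S^0=I_d$. Words and evaluation. Consider finite words $2^r s_{i_0}s_{i_1}\cdots s_{i_k}$ in letters $s_i$ (indexed by non-negative integers $i$) preceded by a power of $2$. For $w=2^r s_{i_0}\cdots s_{i_k}$ and $v=2^t s_{j_0}\cdots s_{j_l}$ set $w\oplus v=2^{r+t+1}s_{i_0}\cdots s_{i_{k-1}}s_{i_k+j_0}s_{j_1}\cdots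 s_{j_l}$ and $w\otimes v=2^{r+t}s_{i_0}\cdots s_{i_k}s_{j_0}\cdots s_{j_l}$ (in particular $s_i\oplus s_j=2s_{i+j}$, $s_i\otimes s_j=s_is_j$). Any mixed expression in these operations is associative. The evaluation extends to words by $\mathrm{Eval}(2^r s_{i_0}\cdots s_{i_k})=2^r\prod_{\ell=0}^k\mathrm{Eval}(s_{i_\ell})$. The symbol $\star$ stands for either $\oplus$ or $\otimes$, and $\sum_\star\mathrm{Eval}(w_0\star w_1\star\cdots\star w_q)$ denotes the sum over all $2^q$ ways of replacing each of the $q$ occurrences of $\star$, independently, by $\oplus$ or $\otimes$. *)

theory Defs
  imports "HOL-Probability.Probability"
begin

(* The class multiplication and power on type vec are componentwise, so matrix powers are
   defined from the matrix product. *)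
primrec mat_pow :: "real^'d^'d \<Rightarrow> nat \<Rightarrow> real^'d^'d" where
  "mat_pow A 0 = mat 1"
| "mat_pow A (Suc n) = A ** mat_pow A n"

definition mat_prod_list :: "(real^'d^'d) list \<Rightarrow> real^'d^'d" where
  "mat_prod_list As = foldr (**) As (mat 1)"

definition outer_square :: "real^'d \<Rightarrow> real^'d^'d" where
  "outer_square x = (columnvector x :: real^1^'d) ** (rowvector x :: real^'d^1)"

definition std_gaussian_vector :: "'a measure \<Rightarrow> ('a \<Rightarrow> real^'d) \<Rightarrow> bool" where
  "std_gaussian_vector M Y \<longleftrightarrow>
     prob_space.indep_vars M (\<lambda>_. borel) (\<lambda>j \<omega>. Y \<omega> $ j) UNIV \<and>
     (\<forall>j. distributed M lborel (\<lambda>\<omega>. Y \<omega> $ j) std_normal_density)"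

(* N(q; k_1,...,k_q | m_q,...,m_1) for the random vectors X_1, X_2, ... on M; only the
   values of X, k, m at the indices 1,...,q are used. *)
definition N_moment ::
  "'a measure \<Rightarrow> (nat \<Rightarrow> 'a \<Rightarrow> real^'d) \<Rightarrow> real^'d^'d \<Rightarrow> nat \<Rightarrow> (nat \<Rightarrow> nat) \<Rightarrow> (nat \<Rightarrow> nat) \<Rightarrow> real"
where
  "N_moment M X S q k m =
     prob_space.expectation M (\<lambda>\<omega>. trace
       (mat_prod_list (map (\<lambda>i. outer_square (X i \<omega>) ** mat_pow S (k i)) [1..<q+1]) **
        mat_prod_list (map (\<lambda>i. outer_square (X (q+1-i) \<omega>) ** mat_pow S (m (q+1-i))) [1..<q+1])))"

(* Word r [i_0, ..., i_k] is the word 2^r s_{i_0} ... s_{i_k}. Words have at least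
   one letter; the empty list only occurs as a junk value. *)
datatype sword = Word nat "nat list"

fun letters :: "sword \<Rightarrow> nat list" where
  "letters (Word r u) = u"

definition letter :: "nat \<Rightarrow> sword" where
  "letter i = Word 0 [i]"

fun word_oplus :: "sword \<Rightarrow> sword \<Rightarrow> sword" where
  "word_oplus (Word r u) (Word t v) = Word (r + t + 1) (butlast u @ (last u + hd v) # tl v)"

fun word_otimes :: "sword \<Rightarrow> sword \<Rightarrow> sword" where
  "word_otimes (Word r u) (Word t v) = Word (r + t) (u @ v)"

fun word_eval :: "(nat \<Rightarrow> real) \<Rightarrow> sword \<Rightarrow> real" where
  "word_eval e (Word r u) = 2 ^ r * (\<Prod>i\<leftarrow>u. e i)"

datatype star = Oplus | Otimes

fun apply_star :: "star \<Rightarrow> sword \<Rightarrow> sword \<Rightarrow> sword" where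
  "apply_star Oplus = word_oplus"
| "apply_star Otimes = word_otimes"

(* w_0 c_1 w_1 c_2 ... c_n w_n, bracketed to the left; by apply_star_assoc the bracketing is
   immaterial for nonempty words. *)
primrec star_expr :: "(nat \<Rightarrow> sword) \<Rightarrow> (nat \<Rightarrow> star) \<Rightarrow> nat \<Rightarrow> sword" where
  "star_expr w c 0 = w 0"
| "star_expr w c (Suc n) = apply_star (c (Suc n)) (star_expr w c n) (w (Suc n))"

lemma apply_star_assoc:
  assumes "letters v \<noteq> []"
  shows "apply_star b (apply_star a u v) w = apply_star a u (apply_star b v w)"
proof -
  obtain r us where u: "u = Word r us" by (cases u)
  obtain t x vs where v: "v = Word t (x # vs)"
    using assms by (metis letters.elims neq_Nil_conv)
  obtain p ws where w: "w = Word p ws" by (cases w)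
  show ?thesis
    unfolding u v w by (cases a; cases b; cases vs) (auto simp: butlast_append)
qed

definition star_sum :: "(nat \<Rightarrow> real) \<Rightarrow> (nat \<Rightarrow> sword) \<Rightarrow> nat \<Rightarrow> real" where
  "star_sum e w q = (\<Sum>c \<in> {1..q} \<rightarrow>\<^sub>E UNIV. word_eval e (star_expr w c q))"

definition alpha :: "nat \<Rightarrow> (nat \<Rightarrow> nat) \<Rightarrow> (nat \<Rightarrow> nat) \<Rightarrow> nat \<Rightarrow> nat" where
  "alpha q k m i = (if i = 0 then m 1 else if i < q then k i + m (i + 1) else k q)"

end

(* By cyclicity the trace is that of T_q, where T_0 = I and
     T_q = X_q X_q^T S^(m_q) T_(q-1) X_q X_q^T S^(k_q).
   X_q is independent of T_(q-1), and Wick's formula for four factors gives, for C independent of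
   the standard Gaussian vector X,
     E[X X^T C X X^T] = D + D^T + Tr(D) I   with D = E[C].
   As S is symmetric, D and D^T contribute equally, so G(q, n) = Tr(E[T_q] S^n) satisfies
     G(q, n) = Tr(S^(k_q + n)) G(q-1, m_q) + 2 G(q-1, m_q + k_q + n).
   Splitting the sum over the stars by the last star gives the same recursion: the two summands are
   the contributions of a last otimes and a last oplus. *)
theory Submission
  imports Defs
begin

section \<open>Matrix powers and the rotated product\<close>

text \<open>This is T_q, built from the inside outwards: each step wraps a new vector around the
  previous product. The bracketing isolates a conjugation \<open>P ** C ** P\<close> by
  \<open>P = outer_square (x (Suc q))\<close>, the shape to which Wick's formula applies, from the
  deterministic factor on the right.\<close>

primrec sandwich :: "(nat \<Rightarrow> real^'d) \<Rightarrow> real^'d^'d \<Rightarrow> (nat \<Rightarrow> nat) \<Rightarrow> (nat \<Rightarrow> nat) \<Rightarrow> nat \<Rightarrow> real^'d^'d" where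
  "sandwich x S k m 0 = mat 1"
| "sandwich x S k m (Suc q) =
     (outer_square (x (Suc q)) ** (mat_pow S (m (Suc q)) ** sandwich x S k m q)
       ** outer_square (x (Suc q))) ** mat_pow S (k (Suc q))"

lemma outer_square_nth: "outer_square x $ i $ j = x $ i * x $ j"
  by (simp add: outer_square_def columnvector_def rowvector_def matrix_matrix_mult_def)

lemma mat_pow_add: "mat_pow A (i + j) = mat_pow A i ** mat_pow A j"
  by (induction i) (simp_all add: matrix_mul_assoc)

lemma transpose_mat_pow:
  assumes "transpose A = A"
  shows "transpose (mat_pow A n) = mat_pow A n"
proof (induction n)
  case (Suc n)
  \<comment> \<open>Transposition leaves the new factor on the right, while \<open>mat_pow\<close>
    adds it on the left; additivity of exponents exchanges the two.\<close>
  have "transpose (mat_pow A (Suc n)) = mat_pow A n ** mat_pow A 1"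
    by (simp add: matrix_transpose_mul assms Suc)
  also have "\<dots> = mat_pow A (n + 1)"
    by (simp only: mat_pow_add)
  finally show ?case by simp
qed (simp add: transpose_mat)

lemma mat_prod_list_Nil: "mat_prod_list [] = mat 1"
  by (simp add: mat_prod_list_def)

lemma mat_prod_list_Cons: "mat_prod_list (A # As) = A ** mat_prod_list As"
  by (simp add: mat_prod_list_def)

lemma mat_prod_list_append: "mat_prod_list (As @ Bs) = mat_prod_list As ** mat_prod_list Bs"
  by (induction As) (simp_all add: mat_prod_list_Nil mat_prod_list_Cons matrix_mul_assoc)

text \<open>Passing to \<open>Suc q\<close> adds one factor in front of the descending product and
  one at the end of the ascending product. The descending product comes first here, opposite to the
  order in \<open>N_moment\<close>.\<close>

lemma sandwich_eq:
  "sandwich x S k m q =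
     mat_prod_list (map (\<lambda>i. outer_square (x (q+1-i)) ** mat_pow S (m (q+1-i))) [1..<q+1]) **
     mat_prod_list (map (\<lambda>i. outer_square (x i) ** mat_pow S (k i)) [1..<q+1])"
proof (induction q)
  case (Suc q)
  \<comment> \<open>Index 1 of the descending product carries the newest vector; shifting the other
    indices by one turns \<open>Suc q + 1 - i\<close> into \<open>q + 1 - i\<close>.\<close>
  have "[1..<Suc q + 1] = 1 # map Suc [1..<q+1]"
    by (metis One_nat_def Suc_eq_plus1 map_Suc_upt upt_conv_Cons zero_less_Suc Suc_less_eq)
  then have "mat_prod_list (map (\<lambda>i. outer_square (x (Suc q+1-i)) ** mat_pow S (m (Suc q+1-i))) [1..<Suc q+1])
    = (outer_square (x (Suc q)) ** mat_pow S (m (Suc q))) **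
      mat_prod_list (map (\<lambda>i. outer_square (x (q+1-i)) ** mat_pow S (m (q+1-i))) [1..<q+1])"
    by (simp add: mat_prod_list_Cons comp_def)
  moreover have "mat_prod_list (map (\<lambda>i. outer_square (x i) ** mat_pow S (k i)) [1..<Suc q+1])
    = mat_prod_list (map (\<lambda>i. outer_square (x i) ** mat_pow S (k i)) [1..<q+1]) **
      (outer_square (x (Suc q)) ** mat_pow S (k (Suc q)))"
    by (simp add: mat_prod_list_append mat_prod_list_Cons mat_prod_list_Nil)
  ultimately show ?case
    by (simp only: sandwich.simps Suc.IH matrix_mul_assoc)
qed (simp add: mat_prod_list_Nil)

section \<open>Words and the recursion for the sum over the stars\<close>

lemma star_expr_cong:
  assumes "\<And>i. i \<le> n \<Longrightarrow> w i = w' i" "\<And>i. 1 \<le> i \<Longrightarrow> i \<le> n \<Longrightarrow> c i = c' i"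
  shows "star_expr w c n = star_expr w' c' n"
  using assms by (induction n) auto

lemma star_sum_cong:
  assumes "\<And>i. i \<le> q \<Longrightarrow> w i = w' i"
  shows "star_sum e w q = star_sum e w' q"
  unfolding star_sum_def using star_expr_cong[of q w w'] assms by auto

text \<open>The letter at position \<open>q\<close> enters only the last letter of the word, and
  additively, whichever star precedes it. The point is the order of the quantifiers:
  \<open>r\<close>, \<open>u\<close> and \<open>z\<close> do not depend on the shift
  \<open>y\<close>.\<close>

lemma star_expr_last_letter:
  "\<exists>r u z. \<forall>y. star_expr (\<lambda>i. letter ((a(q := a q + y)) i)) c q = Word r (u @ [z + y])"
proof (cases q)
  case 0
  show ?thesis
    by (rule exI[of _ 0], rule exI[of _ "[]"], rule exI[of _ "a 0"]) (simp add: 0 letter_def)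
next
  case (Suc n)
  obtain r v where w: "star_expr (\<lambda>i. letter (a i)) c n = Word r v"
    by (cases "star_expr (\<lambda>i. letter (a i)) c n")
  have eq: "star_expr (\<lambda>i. letter ((a(q := a q + y)) i)) c n = Word r v" for y
    unfolding w[symmetric] by (rule star_expr_cong) (auto simp: Suc)
  show ?thesis
  proof (cases "c q")
    case Oplus
    show ?thesis
      by (rule exI[of _ "Suc r"], rule exI[of _ "butlast v"], rule exI[of _ "last v + a q"])
         (use eq Oplus in \<open>simp add: Suc letter_def\<close>)
  next
    case Otimes
    show ?thesis
      by (rule exI[of _ r], rule exI[of _ v], rule exI[of _ "a q"])
         (use eq Otimes in \<open>simp add: Suc letter_def\<close>)
  qed
qed

text \<open>A final otimes appends a separate letter, hence a separate factor. A final oplus merges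
  the new letter into the previous one, as if the exponent at \<open>q\<close> had been larger from
  the start, at the price of one factor 2.\<close>

lemma word_eval_star_expr_Suc:
  fixes a :: "nat \<Rightarrow> nat" and q :: nat
  defines "w \<equiv> \<lambda>i. letter (a i)"
  defines "w' \<equiv> \<lambda>i. letter ((a(q := a q + a (Suc q))) i)"
  shows "word_eval e (word_otimes (star_expr w c q) (w (Suc q))) = e (a (Suc q)) * word_eval e (star_expr w c q)"
    and "word_eval e (word_oplus (star_expr w c q) (w (Suc q))) = 2 * word_eval e (star_expr w' c q)"
proof -
  obtain r u z where *: "\<And>y. star_expr (\<lambda>i. letter ((a(q := a q + y)) i)) c q = Word r (u @ [z + y])"
    using star_expr_last_letter[of a q c] by blast
  have "star_expr w c q = Word r (u @ [z])" "star_expr w' c q = Word r (u @ [z + a (Suc q)])"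
    using *[of 0] *[of "a (Suc q)"] by (simp_all add: w_def w'_def)
  then show "word_eval e (word_otimes (star_expr w c q) (w (Suc q))) = e (a (Suc q)) * word_eval e (star_expr w c q)"
    and "word_eval e (word_oplus (star_expr w c q) (w (Suc q))) = 2 * word_eval e (star_expr w' c q)"
    by (simp_all add: w_def letter_def)
qed

lemma UNIV_star: "UNIV = {Oplus, Otimes}"
  using star.exhaust by auto

lemma star_sum_0: "star_sum e (\<lambda>i. letter (a i)) 0 = e (a 0)"
  by (simp add: star_sum_def letter_def)

lemma star_sum_Suc:
  "star_sum e (\<lambda>i. letter (a i)) (Suc q) =
     e (a (Suc q)) * star_sum e (\<lambda>i. letter (a i)) q +
     2 * star_sum e (\<lambda>i. letter ((a(q := a q + a (Suc q))) i)) q"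
proof -
  let ?w = "\<lambda>i. letter (a i)" and ?P = "{1..q} \<rightarrow>\<^sub>E (UNIV :: star set)"
  let ?w' = "\<lambda>i. letter ((a(q := a q + a (Suc q))) i)"
  have upd: "star_expr ?w (c(Suc q := s)) q = star_expr ?w c q" for c s
    by (rule star_expr_cong) auto
  have ins: "{1..Suc q} = insert (Suc q) {1..q}" by auto
  \<comment> \<open>A choice of stars on \<open>{1..Suc q}\<close> is a pair of the last star and a
    choice on \<open>{1..q}\<close>.\<close>
  have "star_sum e ?w (Suc q) =
      (\<Sum>(s, c) \<in> UNIV \<times> ?P. word_eval e (star_expr ?w (c(Suc q := s)) (Suc q)))"
    unfolding star_sum_def ins PiE_insert_eq
    by (subst sum.reindex) (auto intro!: inj_combinator sum.cong)
  also have "\<dots> = (\<Sum>s\<in>UNIV. \<Sum>c\<in>?P. word_eval e (apply_star s (star_expr ?w c q) (?w (Suc q))))"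
    by (simp add: sum.cartesian_product[symmetric] upd)
  also have "\<dots> = e (a (Suc q)) * star_sum e ?w q + 2 * star_sum e ?w' q"
    by (simp add: UNIV_star word_eval_star_expr_Suc star_sum_def sum_distrib_left)
  finally show ?thesis .
qed

section \<open>Traces and entrywise expectations\<close>

lemma matrix_add_mult_distrib: "((A + B) :: real^'n^'m) ** C = A ** C + B ** C"
  by (simp add: vec_eq_iff matrix_matrix_mult_def distrib_right sum.distrib)

lemma trace_mat_mult: "trace ((mat c :: real^'d^'d) ** A) = c * trace A"
  by (simp add: trace_def matrix_matrix_mult_def mat_def if_distrib[of "\<lambda>x. x * _"] sum_distrib_left cong: if_cong)

lemma trace_transpose: "trace (transpose A) = trace A"
  by (simp add: trace_def transpose_def)

definition mean_mat :: "'a measure \<Rightarrow> ('a \<Rightarrow> real^'n^'m) \<Rightarrow> real^'n^'m" where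
  "mean_mat M F = (\<chi> i j. \<integral>\<omega>. F \<omega> $ i $ j \<partial>M)"

text \<open>The integral of a non-integrable function is 0 by default, so linearity of
  \<open>mean_mat\<close> is stated under this condition.\<close>

definition integrable_mat :: "'a measure \<Rightarrow> ('a \<Rightarrow> real^'n^'m) \<Rightarrow> bool" where
  "integrable_mat M F \<longleftrightarrow> (\<forall>i j. integrable M (\<lambda>\<omega>. F \<omega> $ i $ j))"

lemma mat_mult_nth: "(A ** B) $ i $ j = (\<Sum>l\<in>UNIV. A $ i $ l * B $ l $ j)"
  by (simp add: matrix_matrix_mult_def)

lemma
  assumes "integrable_mat M F"
  shows integrable_mat_mult_left: "integrable_mat M (\<lambda>\<omega>. A ** F \<omega>)"
    and mean_mat_mult_left: "mean_mat M (\<lambda>\<omega>. A ** F \<omega>) = A ** mean_mat M F"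
    and integrable_mat_mult_right: "integrable_mat M (\<lambda>\<omega>. F \<omega> ** B)"
    and mean_mat_mult_right: "mean_mat M (\<lambda>\<omega>. F \<omega> ** B) = mean_mat M F ** B"
  using assms
  by (simp_all add: integrable_mat_def mean_mat_def vec_eq_iff mat_mult_nth)

lemma integral_trace:
  assumes "integrable_mat M F"
  shows "(\<integral>\<omega>. trace (F \<omega>) \<partial>M) = trace (mean_mat M F)"
  using assms by (simp add: integrable_mat_def mean_mat_def trace_def)

section \<open>Wick's formula for four Gaussian factors\<close>

context prob_space
begin

lemma std_normal_moment:
  assumes "distributed M lborel Z std_normal_density"
  shows "integrable M (\<lambda>\<omega>. Z \<omega> ^ n)"
    and "expectation (\<lambda>\<omega>. Z \<omega> ^ n) = (\<integral>x. std_normal_density x * x ^ n \<partial>lborel)"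
  using distributed_integrable[OF assms, of "\<lambda>x. x ^ n"] distributed_integral[OF assms, of "\<lambda>x. x ^ n"]
    integrable_std_normal_moment[of n] by auto

text \<open>Isserlis' theorem for four factors: one summand for each of the three pairings of the
  indices. Coordinates are independent, so the moment factors into one-dimensional moments of orders
  up to 4, which are 0 for odd orders and 1, 1, 3 for orders 0, 2, 4.\<close>

lemma
  fixes Y :: "'a \<Rightarrow> real^'d"
  assumes Y: "std_gaussian_vector M Y"
  shows integrable_gaussian_moment4:
      "integrable M (\<lambda>\<omega>. Y \<omega> $ a * Y \<omega> $ b * Y \<omega> $ c * Y \<omega> $ e)" (is ?int)
    and gaussian_moment4:
      "expectation (\<lambda>\<omega>. Y \<omega> $ a * Y \<omega> $ b * Y \<omega> $ c * Y \<omega> $ e) =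
        of_bool (a = b \<and> c = e) + of_bool (a = c \<and> b = e) + of_bool (a = e \<and> b = c)" (is ?eq)
proof -
  \<comment> \<open>\<open>n j\<close> is the multiplicity of \<open>j\<close> among the four
    indices; equal coordinates are collected into one power before independence is applied.\<close>
  define n :: "'d \<Rightarrow> nat"
    where "n j = of_bool (a = j) + of_bool (b = j) + of_bool (c = j) + of_bool (e = j)" for j
  define \<mu> :: "nat \<Rightarrow> real" where "\<mu> i = (\<integral>x. std_normal_density x * x ^ i \<partial>lborel)" for i
  have \<mu>_even: "\<mu> 0 = 1" "\<mu> 2 = 1" "\<mu> 4 = 3"
    using integral_std_normal_moment_even[of 0] integral_std_normal_moment_even[of 1]
      integral_std_normal_moment_even[of 2]
    by (simp_all add: \<mu>_def fact_numeral)
  have \<mu>_odd: "\<mu> i = 0" if "odd i" for i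
    using that integral_std_normal_moment_odd unfolding \<mu>_def by (metis oddE)
  have prod: "Y \<omega> $ a * Y \<omega> $ b * Y \<omega> $ c * Y \<omega> $ e = (\<Prod>j\<in>UNIV. (Y \<omega> $ j) ^ n j)" for \<omega>
    by (simp add: n_def power_add prod.distrib of_bool_def if_distrib[of "power _"] cong: if_cong)
  have ind: "indep_vars (\<lambda>_. borel) (\<lambda>j \<omega>. (Y \<omega> $ j) ^ n j) UNIV"
    using Y unfolding std_gaussian_vector_def
    by (intro indep_vars_compose2[where M' = "\<lambda>_. borel" and Y = "\<lambda>j x. x ^ n j"]) auto
  have N: "distributed M lborel (\<lambda>\<omega>. Y \<omega> $ j) std_normal_density" for j
    using Y by (simp add: std_gaussian_vector_def)
  show ?int
    unfolding prod by (intro indep_vars_integrable ind std_normal_moment(1) N) simp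
  have "expectation (\<lambda>\<omega>. Y \<omega> $ a * Y \<omega> $ b * Y \<omega> $ c * Y \<omega> $ e) = (\<Prod>j\<in>UNIV. \<mu> (n j))"
    unfolding prod \<mu>_def
    by (subst indep_vars_lebesgue_integral[OF _ ind])
       (auto intro!: std_normal_moment(1) N simp: std_normal_moment(2)[OF N])
  also have "\<dots> = of_bool (a = b \<and> c = e) + of_bool (a = c \<and> b = e) + of_bool (a = e \<and> b = c)"
    (is "_ = ?r")
  proof -
    have one: "of_bool p + of_bool q + of_bool r = (1 :: real)"
      if "p \<and> \<not> q \<and> \<not> r \<or> \<not> p \<and> q \<and> \<not> r \<or> \<not> p \<and> \<not> q \<and> r" for p q r
      using that by auto
    have none: "of_bool p + of_bool q + of_bool r = (0 :: real)" if "\<not> p" "\<not> q" "\<not> r" for p q r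
      using that by auto
    have odd: "(\<Prod>j\<in>UNIV. \<mu> (n j)) = 0" if "odd (n j)" for j
      using that \<mu>_odd[of "n j"] by (intro prod_zero) auto
    have pairs: "(\<Prod>j\<in>UNIV. \<mu> (n j)) = 1" if "\<And>j. n j = 0 \<or> n j = 2"
      using that \<mu>_even by (intro prod.neutral) metis
    have all: "(\<Prod>j\<in>UNIV. \<mu> (n j)) = 3" if "a = b" "b = c" "c = e"
    proof -
      have "n j = (if j = e then 4 else 0)" for j
        using that by (simp add: n_def)
      then have "\<mu> (n j) = (if j = e then 3 else 1)" for j
        using \<mu>_even by simp
      then show ?thesis by simp
    qed
    \<comment> \<open>If all indices agree, all three pairings count and the fourth moment is 3. If
      they form two distinct pairs, exactly one pairing counts and every multiplicity is 0 or 2.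
      Otherwise no pairing counts and some index has odd multiplicity.\<close>
    consider "a = b \<and> b = c \<and> c = e" | "a = b \<and> c = e \<and> a \<noteq> c" | "a = c \<and> b = e \<and> a \<noteq> b"
      | "a = e \<and> b = c \<and> a \<noteq> b" | "\<not> (a = b \<and> c = e)" "\<not> (a = c \<and> b = e)" "\<not> (a = e \<and> b = c)"
      by metis
    then show ?thesis
    proof cases
      case 1
      with all show ?thesis by simp
    next
      case 2
      then have "n j = 0 \<or> n j = 2" for j by (auto simp: n_def)
      then have "(\<Prod>j\<in>UNIV. \<mu> (n j)) = 1" by (rule pairs)
      moreover have "?r = 1" by (rule one) (use 2 in blast)
      ultimately show ?thesis by simp
    next
      case 3
      then have "n j = 0 \<or> n j = 2" for j by (auto simp: n_def)
      then have "(\<Prod>j\<in>UNIV. \<mu> (n j)) = 1" by (rule pairs)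
      moreover have "?r = 1" by (rule one) (use 3 in blast)
      ultimately show ?thesis by simp
    next
      case 4
      then have "n j = 0 \<or> n j = 2" for j by (auto simp: n_def)
      then have "(\<Prod>j\<in>UNIV. \<mu> (n j)) = 1" by (rule pairs)
      moreover have "?r = 1" by (rule one) (use 4 in blast)
      ultimately show ?thesis by simp
    next
      case 5
      then have "odd (n a) \<or> odd (n b) \<or> odd (n c) \<or> odd (n e)"
        by (auto simp: n_def)
      then have "(\<Prod>j\<in>UNIV. \<mu> (n j)) = 0" using odd by blast
      moreover have "?r = 0" by (rule none[OF 5])
      ultimately show ?thesis by simp
    qed
  qed
  finally show ?eq .
qed

lemma
  fixes Y :: "'a \<Rightarrow> real^'d" and C :: "'a \<Rightarrow> real^'d^'d"
  assumes Y: "std_gaussian_vector M Y"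
    \<comment> \<open>\<^term>\<open>indep_var\<close> only relates variables with values in the same type, hence the detour
      through real functions \<open>g\<close> of \<open>Y\<close>.\<close>
    and ind: "\<And>a b g. g \<in> borel_measurable borel \<Longrightarrow>
      indep_var borel (\<lambda>\<omega>. C \<omega> $ a $ b) borel (\<lambda>\<omega>. g (Y \<omega>))"
    and C: "integrable_mat M C"
  shows integrable_mat_outer_conj:
      "integrable_mat M (\<lambda>\<omega>. outer_square (Y \<omega>) ** C \<omega> ** outer_square (Y \<omega>))"
    and mean_mat_outer_conj:
      "mean_mat M (\<lambda>\<omega>. outer_square (Y \<omega>) ** C \<omega> ** outer_square (Y \<omega>)) =
        mean_mat M C + transpose (mean_mat M C) + mat (trace (mean_mat M C))"
proof -
  have nth: "(outer_square y ** A ** outer_square y) $ i $ j =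
      (\<Sum>b\<in>UNIV. \<Sum>a\<in>UNIV. A $ a $ b * (y $ i * y $ a * y $ b * y $ j))"
    for y :: "real^'d" and A i j
    by (simp add: mat_mult_nth outer_square_nth sum_distrib_left sum_distrib_right mult_ac)
  have ind4: "indep_var borel (\<lambda>\<omega>. C \<omega> $ a $ b)
      borel (\<lambda>\<omega>. Y \<omega> $ i * Y \<omega> $ a * Y \<omega> $ b * Y \<omega> $ j)" for a b i j
    by (rule ind) measurable
  have int_C: "integrable M (\<lambda>\<omega>. C \<omega> $ a $ b)" for a b
    using C by (simp add: integrable_mat_def)
  note int = indep_var_integrable[OF ind4 int_C integrable_gaussian_moment4[OF Y]]
  show "integrable_mat M (\<lambda>\<omega>. outer_square (Y \<omega>) ** C \<omega> ** outer_square (Y \<omega>))"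
    by (simp add: integrable_mat_def nth int)
  \<comment> \<open>Independence separates the entry of \<open>C\<close> from the Gaussian monomial,
    whose mean is a sum over pairings of \<open>i\<close>, \<open>a\<close>, \<open>b\<close>,
    \<open>j\<close>.\<close>
  have "expectation (\<lambda>\<omega>. (outer_square (Y \<omega>) ** C \<omega> ** outer_square (Y \<omega>)) $ i $ j) =
      (\<Sum>b\<in>UNIV. \<Sum>a\<in>UNIV. mean_mat M C $ a $ b *
        (of_bool (i = a \<and> b = j) + of_bool (i = b \<and> a = j) + of_bool (i = j \<and> a = b)))" for i j
    by (simp add: nth int mean_mat_def gaussian_moment4[OF Y]
        indep_var_lebesgue_integral[OF ind4 int_C integrable_gaussian_moment4[OF Y]])
  \<comment> \<open>In order, the pairings select the entry at (i, j), the entry at (j, i) and, on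
    the diagonal only, the trace.\<close>
  also have "\<dots> i j = (mean_mat M C + transpose (mean_mat M C) + mat (trace (mean_mat M C))) $ i $ j" for i j
  proof -
    have pick: "(\<Sum>b\<in>UNIV. \<Sum>a\<in>UNIV. f a b * of_bool (u = a \<and> v = b)) = f u v"
      for f :: "'d \<Rightarrow> 'd \<Rightarrow> real" and u v
    proof -
      have "(\<Sum>a\<in>UNIV. f a b * of_bool (u = a \<and> v = b)) = (if v = b then f u v else 0)" for b
        by (simp add: of_bool_def if_distrib[of "times _"] cong: if_cong)
      then show ?thesis by simp
    qed
    have diag: "(\<Sum>b\<in>UNIV. \<Sum>a\<in>UNIV. f a b * of_bool (i = j \<and> a = b)) =
        of_bool (i = j) * (\<Sum>b\<in>UNIV. f b b)" for f :: "'d \<Rightarrow> 'd \<Rightarrow> real"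
      by (simp add: of_bool_def if_distrib[of "times _"] cong: if_cong)
    have pick': "(\<Sum>b\<in>UNIV. \<Sum>a\<in>UNIV. f a b * of_bool (u = b \<and> v = a)) = f v u"
      for f :: "'d \<Rightarrow> 'd \<Rightarrow> real" and u v
    proof -
      have "u = b \<and> v = a \<longleftrightarrow> v = a \<and> u = b" for a b
        by auto
      then show ?thesis by (simp only: pick)
    qed
    have swap: "i = a \<and> b = j \<longleftrightarrow> i = a \<and> j = b" for a b
      by auto
    show ?thesis
      unfolding distrib_left sum.distrib swap pick pick' diag
      by (simp add: transpose_def mat_def trace_def)
  qed
  finally show "mean_mat M (\<lambda>\<omega>. outer_square (Y \<omega>) ** C \<omega> ** outer_square (Y \<omega>)) =
      mean_mat M C + transpose (mean_mat M C) + mat (trace (mean_mat M C))"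
    by (simp add: vec_eq_iff mean_mat_def)
qed

end

section \<open>Measurability and independence\<close>

lemma sandwich_cong:
  assumes "\<And>i. 1 \<le> i \<Longrightarrow> i \<le> q \<Longrightarrow> x i = y i"
  shows "sandwich x S k m q = sandwich y S k m q"
  using assms by (induction q) auto

text \<open>The index set \<open>{1..p}\<close> of the product space stays fixed while
  \<open>q\<close> grows, so the induction hypothesis speaks of the same space as the goal.\<close>

lemma measurable_sandwich:
  assumes "q \<le> p"
  shows "(\<lambda>x. sandwich x S k m q $ a $ b) \<in> borel_measurable (PiM {1..p} (\<lambda>_. borel))"
  using assms
proof (induction q arbitrary: a b)
  case (Suc q)
  have [measurable]: "(\<lambda>x. sandwich x S k m q $ a $ b) \<in> borel_measurable (PiM {1..p} (\<lambda>_. borel))" for a b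
    using Suc by simp
  have "(\<lambda>x. x (Suc q)) \<in> measurable (PiM {1..p} (\<lambda>_. borel :: (real^'a) measure)) borel"
    using Suc.prems by (intro measurable_component_singleton) auto
  then have [measurable]:
    "(\<lambda>x. x (Suc q) $ i) \<in> borel_measurable (PiM {1..p} (\<lambda>_. borel :: (real^'a) measure))" for i
    by (rule measurable_compose) (rule borel_measurable_nth)
  show ?case
    unfolding sandwich.simps mat_mult_nth outer_square_nth by measurable
qed simp

context prob_space
begin

text \<open>T_q is a measurable function of the first \<open>q\<close> vectors, and the blocks
  \<open>{1..q}\<close> and \<open>{Suc q}\<close> are disjoint.\<close>

lemma indep_var_sandwich:
  fixes X :: "nat \<Rightarrow> 'a \<Rightarrow> real^'d"
  assumes "indep_vars (\<lambda>_. borel) X {1..}"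
    and g [measurable]: "g \<in> borel_measurable borel"
  shows "indep_var borel (\<lambda>\<omega>. (A ** sandwich (\<lambda>i. X i \<omega>) S k m q) $ a $ b)
    borel (\<lambda>\<omega>. g (X (Suc q) \<omega>))"
proof -
  have "indep_var (PiM {1..q} (\<lambda>_. borel)) (\<lambda>\<omega>. restrict (\<lambda>i. X i \<omega>) {1..q})
      (PiM {Suc q} (\<lambda>_. borel)) (\<lambda>\<omega>. restrict (\<lambda>i. X i \<omega>) {Suc q})"
    using assms(1) by (intro indep_var_restrict) auto
  moreover have [measurable]: "(\<lambda>x. sandwich x S k m q $ a $ b) \<in>
      borel_measurable (PiM {1..q} (\<lambda>_. borel))" for a b
    by (rule measurable_sandwich) simp
  have "(\<lambda>x. (A ** sandwich x S k m q) $ a $ b) \<in>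
      borel_measurable (PiM {1..q} (\<lambda>_. borel))"
    unfolding mat_mult_nth by measurable
  moreover have [measurable]: "(\<lambda>x. x (Suc q)) \<in>
      measurable (PiM {Suc q} (\<lambda>_. borel :: (real^'d) measure)) borel"
    by (intro measurable_component_singleton) auto
  have "(\<lambda>x. g (x (Suc q))) \<in> measurable (PiM {Suc q} (\<lambda>_. borel :: (real^'d) measure)) borel"
    by measurable
  ultimately have "indep_var borel
      ((\<lambda>x. (A ** sandwich x S k m q) $ a $ b) \<circ> (\<lambda>\<omega>. restrict (\<lambda>i. X i \<omega>) {1..q}))
      borel ((\<lambda>x. g (x (Suc q))) \<circ> (\<lambda>\<omega>. restrict (\<lambda>i. X i \<omega>) {Suc q}))"
    by (rule indep_var_compose)
  \<comment> \<open>Outside \<open>{1..q}\<close> the restriction is \<open>undefined\<close>, but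
    \<open>sandwich\<close> reads only the indices 1 to \<open>q\<close>.\<close>
  moreover have "sandwich (restrict (\<lambda>i. X i \<omega>) {1..q}) S k m q = sandwich (\<lambda>i. X i \<omega>) S k m q" for \<omega>
    by (rule sandwich_cong) auto
  ultimately show ?thesis by (simp add: comp_def)
qed

section \<open>Recursion for the expected trace\<close>

lemma
  fixes X :: "nat \<Rightarrow> 'a \<Rightarrow> real^'d" and S :: "real^'d^'d" and k m :: "nat \<Rightarrow> nat"
  assumes ind: "indep_vars (\<lambda>_. borel) X {1..}"
    and gauss: "\<And>i. i \<ge> 1 \<Longrightarrow> std_gaussian_vector M (X i)"
  defines "T \<equiv> \<lambda>q \<omega>. sandwich (\<lambda>i. X i \<omega>) S k m q"
  shows integrable_sandwich: "integrable_mat M (T q)"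
    and mean_sandwich_Suc: "mean_mat M (T (Suc q)) =
      (let D = mat_pow S (m (Suc q)) ** mean_mat M (T q)
       in (D + transpose D + mat (trace D)) ** mat_pow S (k (Suc q)))"
proof -
  \<comment> \<open>Integrability of T_q alone yields both integrability of T_(q+1) and the formula
    for its mean; induction from the constant T_0 then makes the formula unconditional.\<close>
  have step: "integrable_mat M (T (Suc q)) \<and> mean_mat M (T (Suc q)) =
      (let D = mat_pow S (m (Suc q)) ** mean_mat M (T q)
       in (D + transpose D + mat (trace D)) ** mat_pow S (k (Suc q)))"
    if T: "integrable_mat M (T q)" for q
  proof -
    have C: "integrable_mat M (\<lambda>\<omega>. mat_pow S (m (Suc q)) ** T q \<omega>)"
      using T by (rule integrable_mat_mult_left)
    have "indep_var borel (\<lambda>\<omega>. (mat_pow S (m (Suc q)) ** T q \<omega>) $ a $ b)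
        borel (\<lambda>\<omega>. g (X (Suc q) \<omega>))" if "g \<in> borel_measurable borel" for a b g
      unfolding T_def using ind that by (rule indep_var_sandwich)
    note outer = integrable_mat_outer_conj[OF gauss this C] mean_mat_outer_conj[OF gauss this C]
    show ?thesis
      using outer T
      by (simp add: T_def Let_def integrable_mat_mult_right mean_mat_mult_right mean_mat_mult_left)
  qed
  have int: "integrable_mat M (T q)" for q
  proof (induction q)
    case 0
    show ?case by (simp add: T_def integrable_mat_def)
  qed (use step in blast)
  show "integrable_mat M (T q)"
    by (rule int)
  show "mean_mat M (T (Suc q)) =
      (let D = mat_pow S (m (Suc q)) ** mean_mat M (T q)
       in (D + transpose D + mat (trace D)) ** mat_pow S (k (Suc q)))"
    using step[OF int] by blast
qed

text \<open>The letter at position \<open>q\<close> carries the extra exponent \<open>n\<close>, which makes the induction on \<open>q\<close> go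
  through; there is no \<open>k 0\<close>, so its value is replaced by \<open>0\<close>.\<close>
lemma trace_mean_sandwich:
  fixes X :: "nat \<Rightarrow> 'a \<Rightarrow> real^'d"
  assumes "indep_vars (\<lambda>_. borel) X {1..}"
    and "\<And>i. i \<ge> 1 \<Longrightarrow> std_gaussian_vector M (X i)"
    and sym: "transpose S = S"
  shows "trace (mean_mat M (\<lambda>\<omega>. sandwich (\<lambda>i. X i \<omega>) S k m q) ** mat_pow S n) =
    star_sum (\<lambda>i. trace (mat_pow S i))
      (\<lambda>i. letter ((if i = 0 then 0 else k i) + (if i < q then m (Suc i) else n))) q"
proof (induction q arbitrary: n)
  case 0
  have "mean_mat M (\<lambda>\<omega>. mat 1) = (mat 1 :: real^'d^'d)"
    by (simp add: mean_mat_def vec_eq_iff prob_space)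
  then show ?case
    by (simp add: star_sum_0)
next
  case (Suc q)
  let ?E = "mean_mat M (\<lambda>\<omega>. sandwich (\<lambda>i. X i \<omega>) S k m q)"
  let ?e = "\<lambda>i. trace (mat_pow S i)"
  let ?a = "\<lambda>q n i. (if i = 0 then 0 else k i) + (if i < q then m (Suc i) else n)"
  define D where "D = mat_pow S (m (Suc q)) ** ?E"
  \<comment> \<open>Cyclicity carries the power of \<open>S\<close> on the left of \<open>?E\<close>
    round to the right, where exponents add.\<close>
  have D: "trace (D ** mat_pow S j) = trace (?E ** mat_pow S (m (Suc q) + j))" for j
    using trace_mul_sym[of "mat_pow S (m (Suc q))" "?E ** mat_pow S j"]
    by (simp add: D_def mat_pow_add matrix_mul_assoc add.commute[of "m (Suc q)"])
  have D0: "trace D = trace (?E ** mat_pow S (m (Suc q)))"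
    using D[of 0] by simp
  \<comment> \<open>Symmetry of \<open>S\<close> enters here: this is what turns the two transposed
    terms into the factor 2.\<close>
  have tD: "trace (transpose D ** mat_pow S j) = trace (D ** mat_pow S j)" for j
  proof -
    have "trace (transpose D ** mat_pow S j) = trace (transpose (transpose D ** mat_pow S j))"
      by (simp add: trace_transpose)
    also have "\<dots> = trace (mat_pow S j ** D)"
      by (simp add: matrix_transpose_mul transpose_mat_pow[OF sym])
    also have "\<dots> = trace (D ** mat_pow S j)"
      by (rule trace_mul_sym)
    finally show ?thesis .
  qed
  have "trace (mean_mat M (\<lambda>\<omega>. sandwich (\<lambda>i. X i \<omega>) S k m (Suc q)) ** mat_pow S n) =
      trace ((D + transpose D + mat (trace D)) ** mat_pow S (k (Suc q) + n))"
    using mean_sandwich_Suc[OF assms(1,2), of S k m q]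
    by (simp add: D_def Let_def mat_pow_add matrix_mul_assoc)
  also have "\<dots> = ?e (k (Suc q) + n) * trace (?E ** mat_pow S (m (Suc q))) +
      2 * trace (?E ** mat_pow S (m (Suc q) + (k (Suc q) + n)))"
    by (simp add: matrix_add_mult_distrib trace_add tD trace_mat_mult D D0)
  \<comment> \<open>The induction hypothesis is used with two different values of the extra
    exponent, hence \<open>n\<close> is arbitrary in the induction.\<close>
  also have "\<dots> = ?e (k (Suc q) + n) * star_sum ?e (\<lambda>i. letter (?a q (m (Suc q)) i)) q +
      2 * star_sum ?e (\<lambda>i. letter (?a q (m (Suc q) + (k (Suc q) + n)) i)) q"
    by (simp only: Suc.IH)
  \<comment> \<open>Position \<open>q\<close> is no longer last in \<open>?a (Suc q) n\<close>, so
    it carries \<open>m (Suc q)\<close> there: the first word agrees up to \<open>q\<close>, and the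
    second has the last two letters merged.\<close>
  also have "\<dots> = ?e (?a (Suc q) n (Suc q)) * star_sum ?e (\<lambda>i. letter (?a (Suc q) n i)) q +
      2 * star_sum ?e (\<lambda>i. letter (((?a (Suc q) n)(q := ?a (Suc q) n q + ?a (Suc q) n (Suc q))) i)) q"
    by (intro arg_cong2[of _ _ _ _ "(+)"] arg_cong2[of _ _ _ _ "(*)"] star_sum_cong refl)
       (auto simp: le_less add.assoc)
  also have "\<dots> = star_sum ?e (\<lambda>i. letter (?a (Suc q) n i)) (Suc q)"
    by (rule star_sum_Suc[symmetric])
  finally show ?case .
qed

end

theorem lemma4p2:
  fixes M :: "'a measure"
    and X :: "nat \<Rightarrow> 'a \<Rightarrow> real^'d"
    and B :: "real^'d^'n"
    and S :: "real^'d^'d"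
    and q :: nat
    and k m :: "nat \<Rightarrow> nat"
  assumes "prob_space M"
    and "prob_space.indep_vars M (\<lambda>_. borel) X {1..}"
    and "\<And>i. i \<ge> 1 \<Longrightarrow> std_gaussian_vector M (X i)"
    and "S = transpose B ** B"
    and "q \<ge> 1"
  shows "N_moment M X S q k m =
    star_sum (\<lambda>i. trace (mat_pow S i)) (\<lambda>i. letter (alpha q k m i)) q"
proof -
  interpret prob_space M by fact
  let ?T = "\<lambda>\<omega>. sandwich (\<lambda>i. X i \<omega>) S k m q"
  have sym: "transpose S = S"
    by (simp add: assms(4) matrix_transpose_mul)
  have "N_moment M X S q k m = expectation (\<lambda>\<omega>. trace (?T \<omega>))"
    \<comment> \<open>Cyclicity of the trace exchanges the ascending and the descending
      product.\<close>
    unfolding N_moment_def sandwich_eq by (subst trace_mul_sym) simp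
  also have "\<dots> = trace (mean_mat M ?T ** mat_pow S 0)"
    using integral_trace[OF integrable_sandwich[OF assms(2,3)]] by simp
  also have "\<dots> = star_sum (\<lambda>i. trace (mat_pow S i)) (\<lambda>i. letter (alpha q k m i)) q"
    \<comment> \<open>For extra exponent 0 the letters are those of \<open>alpha\<close>; as
      \<open>q \<ge> 1\<close>, position 0 is not the last one and carries
      \<open>m 1\<close>.\<close>
    by (rule trans[OF trace_mean_sandwich[OF assms(2,3) sym]], simp, rule star_sum_cong) (use assms(5) in \<open>auto simp: alpha_def\<close>)
  finally show ?thesis .
qed
end
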